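(* Let $X$ be a random $d$-vector with a semi-lattice distribution, and let $\psi_X(\mathbf{t}) = \mathbb{E}[\exp(i\,\mathbf{t}\cdot X)]$, $\mathbf{t}\in\mathbb{R}^d$, be its characteristic function. Then there exists a vector $\mathbf{t^*} \in \mathbb{R}^d \setminus \{0\}$ such that the function $r \mapsto |\psi_X(r\mathbf{t^*})|$ on $\mathbb{R}$ is periodic. In particular, $\limsup_{\|\mathbf{t}\| \to \infty} |\psi_{X}(\mathbf{t})| = 1$.
   Context: Semi-lattice distribution: a random $d$-vector $X$ has a semi-lattice distribution if there exists $\mathbf{t^*} \in \mathbb{R}^d \setminus \{0\}$ such that $\mathbf{t^*} \cdot X$ takes values almost surely in a set $\{x_0 + k\delta : k\in\mathbb{Z}\}$ for some $x_0, \delta \in \mathbb{R}$. Constant functions are considered periodic. *)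

theory Defs
  imports "HOL-Probability.Probability" "HOL-Library.Periodic_Fun"
begin

(* The case delta = 0, where t \<bullet> X is almost surely constant, is allowed. *)
definition semi_lattice_distributed :: "'a measure \<Rightarrow> ('a \<Rightarrow> real ^ 'd) \<Rightarrow> bool" where
  "semi_lattice_distributed M X \<longleftrightarrow>
     (\<exists>t. t \<noteq> 0 \<and>
       (\<exists>x0 \<delta> :: real. AE \<omega> in M. t \<bullet> X \<omega> \<in> {x0 + of_int k * \<delta> | k :: int. True}))"

(* The library constant char is only for measures on the real line. *)
definition char_fun :: "'a measure \<Rightarrow> ('a \<Rightarrow> real ^ 'd) \<Rightarrow> real ^ 'd \<Rightarrow> complex" where
  "char_fun M X t = (CLINT \<omega>|M. iexp (t \<bullet> X \<omega>))"

(* No minimal period is required, so constant functions are periodic. *)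
definition periodic :: "(real \<Rightarrow> 'b) \<Rightarrow> bool" where
  "periodic f \<longleftrightarrow> (\<exists>p>0. periodic_fun_simple f p)"

end

theory Submission
  imports Defs
begin

text \<open>If \<open>t \<bullet> X\<close> lives on \<open>x0 + \<delta> \<int>\<close> and \<open>p\<close> satisfies \<open>p * \<delta> \<in> 2 \<pi> \<int>\<close>, then
  \<open>iexp (p * (t \<bullet> X))\<close> is almost surely the unimodular constant \<open>iexp (p * x0)\<close>. Hence moving the
  argument of the characteristic function by \<open>p t\<close> only multiplies its value by this constant,
  and along the multiples of \<open>p t\<close> the modulus stays at its value \<open>1\<close> at the origin.\<close>

lemma iexp_lattice_const:
  fixes x0 \<delta> p :: real
  assumes "x \<in> {x0 + of_int k * \<delta> | k :: int. True}"
    and "p * \<delta> = 2 * pi * of_int m"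
  shows "iexp (p * x) = iexp (p * x0)"
proof -
  obtain k :: int where x: "x = x0 + of_int k * \<delta>"
    using assms(1) by blast
  have "p * x = p * x0 + of_int k * (p * \<delta>)"
    by (simp add: x algebra_simps)
  also have "\<dots> = p * x0 + 2 * of_int (k * m) * pi"
    by (simp add: assms(2))
  \<comment> \<open>\<open>exp_eq\<close> wants exponents differing by an even integer times
    \<open>pi * \<i>\<close>; that integer is \<open>2 * (k * m)\<close>.\<close>
  finally have "\<i> * complex_of_real (p * x)
      = \<i> * complex_of_real (p * x0) + of_int (2 * (k * m)) * pi * \<i>"
    by (simp add: algebra_simps)
  then show ?thesis
    unfolding exp_eq by blast
qed

text \<open>Almost surely the integrand only gains the factor \<open>iexp (p * x0)\<close>, which
  does not depend on \<open>\<omega>\<close> and so leaves the integral.\<close>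

lemma char_fun_shift:
  fixes X :: "'a \<Rightarrow> real ^ 'd"
  assumes [measurable]: "X \<in> borel_measurable M"
    and lattice: "AE \<omega> in M. t \<bullet> X \<omega> \<in> {x0 + of_int k * \<delta> | k :: int. True}"
    and p: "p * \<delta> = 2 * pi * of_int m"
  shows "char_fun M X (s + p *\<^sub>R t) = iexp (p * x0) * char_fun M X s"
proof -
  have "char_fun M X (s + p *\<^sub>R t) = (CLINT \<omega>|M. iexp (p * x0) * iexp (s \<bullet> X \<omega>))"
    unfolding char_fun_def
  proof (rule integral_cong_AE)
    show "AE \<omega> in M. iexp ((s + p *\<^sub>R t) \<bullet> X \<omega>) = iexp (p * x0) * iexp (s \<bullet> X \<omega>)"
      using lattice
    proof eventually_elim
      case (elim \<omega>)
      have "iexp ((s + p *\<^sub>R t) \<bullet> X \<omega>) = iexp (p * (t \<bullet> X \<omega>)) * iexp (s \<bullet> X \<omega>)"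
        by (simp add: inner_add_left exp_add [symmetric] algebra_simps)
      then show ?case
        by (simp only: iexp_lattice_const [OF elim p])
    qed
  qed measurable
  then show ?thesis
    by (simp add: char_fun_def)
qed

lemma char_fun_zero:
  assumes "prob_space M"
  shows "char_fun M X 0 = 1"
  using assms by (simp add: char_fun_def prob_space.prob_space)

lemma norm_char_fun_le_1:
  assumes "prob_space M"
  shows "cmod (char_fun M X t) \<le> 1"
proof -
  have "cmod (char_fun M X t) \<le> (LINT \<omega>|M. cmod (iexp (t \<bullet> X \<omega>)))"
    unfolding char_fun_def by (rule integral_norm_bound)
  then show ?thesis
    using assms by (simp add: prob_space.prob_space)
qed

text \<open>The multiples of \<open>v\<close> leave every ball, so each neighbourhood of infinity
  contains one of them, and the supremum of \<open>f\<close> there is at least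
  \<open>c\<close>.\<close>

lemma Limsup_at_infinity_ge_along_multiples:
  fixes f :: "'a :: real_normed_vector \<Rightarrow> 'b :: complete_lattice"
  assumes "v \<noteq> 0" and "\<And>n :: nat. c \<le> f (real n *\<^sub>R v)"
  shows "c \<le> Limsup at_infinity f"
  unfolding Limsup_def
proof (rule INF_greatest)
  fix P :: "'a \<Rightarrow> bool"
  assume "P \<in> {P. eventually P at_infinity}"
  then obtain b where b: "\<And>x. b \<le> norm x \<Longrightarrow> P x"
    by (auto simp: eventually_at_infinity)
  obtain n :: nat where "b / norm v \<le> real n"
    using real_arch_simple by blast
  then have "P (real n *\<^sub>R v)"
    using \<open>v \<noteq> 0\<close> by (intro b) (simp add: divide_simps)
  then show "c \<le> Sup (f ` Collect P)"
    using assms(2) by (intro SUP_upper2) auto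
qed

theorem proposition2p8:
  fixes M :: "'a measure" and X :: "'a \<Rightarrow> real ^ 'd"
  assumes "prob_space M"
    and "X \<in> borel_measurable M"
    and "semi_lattice_distributed M X"
  shows "(\<exists>t. t \<noteq> 0 \<and> periodic (\<lambda>r. cmod (char_fun M X (r *\<^sub>R t))))
       \<and> Limsup at_infinity (\<lambda>t. ereal (cmod (char_fun M X t))) = 1"
proof -
  obtain t x0 \<delta> where "t \<noteq> 0"
    and lattice: "AE \<omega> in M. t \<bullet> X \<omega> \<in> {x0 + of_int k * \<delta> | k :: int. True}"
    using assms(3) unfolding semi_lattice_distributed_def by blast
  \<comment> \<open>For \<open>\<delta> = 0\<close> any positive \<open>p\<close> works with
    \<open>m = 0\<close>. Otherwise the absolute value in
    \<open>2 * pi / \<bar>\<delta>\<bar>\<close> keeps the period positive, and \<open>m\<close>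
    carries the sign of \<open>\<delta>\<close>.\<close>
  obtain p :: real and m :: int where "p > 0" and p: "p * \<delta> = 2 * pi * of_int m"
  proof (cases "\<delta> = 0")
    case True
    then show ?thesis
      using that [of 1 0] by simp
  next
    case False
    then show ?thesis
      using that [of "2 * pi / \<bar>\<delta>\<bar>" "if \<delta> > 0 then 1 else - 1"] by (auto simp: field_simps)
  qed
  \<comment> \<open>As \<open>p * x0\<close> is real, the factor \<open>iexp (p * x0)\<close> has
    modulus 1.\<close>
  have shift: "cmod (char_fun M X (s + p *\<^sub>R t)) = cmod (char_fun M X s)" for s
    by (simp add: char_fun_shift [OF assms(2) lattice p] norm_mult)
  have "periodic_fun_simple (\<lambda>r. cmod (char_fun M X (r *\<^sub>R t))) p"
    by unfold_locales (simp add: scaleR_add_left shift)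
  then have "periodic (\<lambda>r. cmod (char_fun M X (r *\<^sub>R t)))"
    using \<open>p > 0\<close> unfolding periodic_def by blast
  moreover have "cmod (char_fun M X (real n *\<^sub>R p *\<^sub>R t)) = 1" for n
  proof (induction n)
    case 0
    show ?case
      by (simp add: char_fun_zero [OF assms(1)])
  next
    case (Suc n)
    then show ?case
      using shift [of "real n *\<^sub>R p *\<^sub>R t"] by (simp add: algebra_simps)
  qed
  \<comment> \<open>The direction \<open>p *\<^sub>R t\<close> is nonzero, so its multiples, where
    the modulus is 1, tend to infinity.\<close>
  then have "1 \<le> Limsup at_infinity (\<lambda>t. ereal (cmod (char_fun M X t)))"
    using \<open>p > 0\<close> \<open>t \<noteq> 0\<close>
    by (intro Limsup_at_infinity_ge_along_multiples [of "p *\<^sub>R t"]) auto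
  moreover have "Limsup at_infinity (\<lambda>t. ereal (cmod (char_fun M X t))) \<le> 1"
    by (intro Limsup_bounded always_eventually allI) (simp add: norm_char_fun_le_1 [OF assms(1)])
  ultimately show ?thesis
    using \<open>t \<noteq> 0\<close> by (blast intro: antisym)
qed

end
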